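(* Let $G = (V, E)$ be a topological graph and let $\Gamma \subseteq \mathrm{Aut}(G)$ be a compact group. If $V$ is a homogeneous $\Gamma$-space and if $\omega$ is the pushforward to $V$ of the Haar measure on $\Gamma$, then $\mathrm{lass}_k(G) \geq \alpha_\omega(G)$ for all integers $k \geq 1$ and $\Delta_k(G) \geq \alpha_\omega(G)$ for all integers $k \geq 2$.
   Context: Graphs. A topological graph is a graph $G=(V,E)$ whose vertex set $V$ is a topological space; $E$ is regarded as a symmetric subset of $V\times V$ (no loops). A set of vertices is independent if it contains no edge. $\mathrm{Aut}(G)$ is the group of edge-preserving bijections $V\to V$. For a Borel measure $\omega$ on $V$, $\alpha_\omega(G) = \sup\{\omega(I) : I\subseteq V \text{ independent and measurable}\}$. Groups. Topological groups are Hausdorff. An action of a locally compact group $\Gamma$ on a locally compact Hausdorff space $V$ is a continuous map $\Gamma\times V\to V$, $(\sigma,x)\mapsto\sigma x$, such that each $x\mapsto\sigma x$ is a homeomorphism and $\sigma(\tau x)=(\sigma\tau)x$. $V$ is a homogeneous $\Gamma$-space if the action is transitive and, for $e\in V$, the map $\Gamma\to V$, $\sigma\mapsto\sigma e$, is open. Here $\Gamma\subseteq\mathrm{Aut}(G)$ acts on $V$ by the automorphisms. The Haar measure $\mu$ on a compact group is normalized by $\mu(\Gamma)=1$; its pushforward $\omega$ to $V$ is the Radon measure with $\int_V f\,d\omega=\int_\Gamma f(\sigma e)\,d\mu(\sigma)$ (independent of $e\in V$). Spaces of subsets. For an integer $k\ge 0$, $\mathrm{Sub}(V,k)$ is the collection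 of all subsets of $V$ of cardinality at most $k$ (including $\emptyset$). For $k\geq1$, $\mathrm{Sub}(V,k)\setminus\{\emptyset\}$ has the quotient topology of the map $V^k\to \mathrm{Sub}(V,k)\setminus\{\emptyset\}$, $(v_1,\dots,v_k)\mapsto\{v_1,\dots,v_k\}$, and $\mathrm{Sub}(V,k)$ is the topological disjoint union of this space with $\{\emptyset\}$. $C(X)$ is the space of real-valued continuous functions on $X$. A continuous symmetric kernel $K\colon X\times X\to\mathbb{R}$ is positive semidefinite if $(K(x,y))_{x,y\in U}$ is a positive-semidefinite matrix for every finite $U\subseteq X$. Lasserre hierarchy. For $k\ge1$ and $\nu\in C(\mathrm{Sub}(V,2k))$ let $(M\nu)(S,T)=\nu(S\cup T)$ for $S,T\in\mathrm{Sub}(V,k)$. Then $\mathrm{lass}_k(G)$ is the supremum of $\int_V\nu(\{x\})\,d\omega(x)$ over all $\nu\in C(\mathrm{Sub}(V,2k))$ such that $\nu(\emptyset)=1$, $\nu(S)=0$ whenever $S\in \mathrm{Sub}(V,2k)$ is not independent, and $M\nu$ is positive semidefinite. $k$-point bound. For $k\ge2$, $\nu\in C(\mathrm{Sub}(V,k))$ and $Q\subseteq V$ with $|Q|\le k-2$, let $(M_Q\nu)(S,T)=\nu(Q\cup S\cup T)$ for $S,T\in\mathrm{Sub}(V,1)$. Then $\Delta_k(G)$ is the supremum of $\int_V\nu(\{x\})\,d\omega(x)$ over all $\nu\in C(\mathrm{Sub}(V,k))$ such that $\nu(\emptyset)=1$, $\nu(S)=0$ whenever $S\in\mathrm{Sub}(V,k)$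 is not independent, and $M_Q\nu$ is positive semidefinite for every independent $Q\in\mathrm{Sub}(V,k-2)$. *)

theory Defs
  imports "HOL-Analysis.Analysis" "HOL-Algebra.Group" "HOL-Algebra.Coset"
begin

definition topological_group :: "('g, 'm) monoid_scheme \<Rightarrow> 'g topology \<Rightarrow> bool" where
  "topological_group G T \<longleftrightarrow>
     group G \<and> topspace T = carrier G \<and> Hausdorff_space T \<and>
     continuous_map (prod_topology T T) T (\<lambda>(\<sigma>, \<tau>). \<sigma> \<otimes>\<^bsub>G\<^esub> \<tau>) \<and>
     continuous_map T T (m_inv G)"

definition continuous_action ::
    "('g, 'm) monoid_scheme \<Rightarrow> 'g topology \<Rightarrow> 'v topology \<Rightarrow> ('g \<Rightarrow> 'v \<Rightarrow> 'v) \<Rightarrow> bool" where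
  "continuous_action G T X \<phi> \<longleftrightarrow>
     topological_group G T \<and> locally_compact_space T \<and>
     locally_compact_space X \<and> Hausdorff_space X \<and>
     continuous_map (prod_topology T X) X (\<lambda>(\<sigma>, x). \<phi> \<sigma> x) \<and>
     (\<forall>\<sigma>\<in>carrier G. homeomorphic_map X X (\<phi> \<sigma>)) \<and>
     (\<forall>\<sigma>\<in>carrier G. \<forall>\<tau>\<in>carrier G. \<forall>x\<in>topspace X. \<phi> \<sigma> (\<phi> \<tau> x) = \<phi> (\<sigma> \<otimes>\<^bsub>G\<^esub> \<tau>) x)"

definition homogeneous_space ::
    "('g, 'm) monoid_scheme \<Rightarrow> 'g topology \<Rightarrow> 'v topology \<Rightarrow> ('g \<Rightarrow> 'v \<Rightarrow> 'v) \<Rightarrow> bool" where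
  "homogeneous_space G T X \<phi> \<longleftrightarrow>
     continuous_action G T X \<phi> \<and>
     (\<forall>x\<in>topspace X. \<forall>y\<in>topspace X. \<exists>\<sigma>\<in>carrier G. \<phi> \<sigma> x = y) \<and>
     (\<forall>e\<in>topspace X. open_map T X (\<lambda>\<sigma>. \<phi> \<sigma> e))"

definition borel_of :: "'a topology \<Rightarrow> 'a measure" where
  "borel_of X = sigma (topspace X) {U. openin X U}"

definition radon_measure :: "'a topology \<Rightarrow> 'a measure \<Rightarrow> bool" where
  "radon_measure X M \<longleftrightarrow>
     sets M = sets (borel_of X) \<and>
     (\<forall>K\<in>sets M. compactin X K \<longrightarrow> emeasure M K < \<infinity>) \<and>
     (\<forall>A\<in>sets M. emeasure M A = (INF U\<in>{U. openin X U \<and> A \<subseteq> U}. emeasure M U)) \<and>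
     (\<forall>U. openin X U \<longrightarrow>
        emeasure M U = (SUP K\<in>{K\<in>sets M. compactin X K \<and> K \<subseteq> U}. emeasure M K))"

definition normalized_haar_measure ::
    "('g, 'm) monoid_scheme \<Rightarrow> 'g topology \<Rightarrow> 'g measure \<Rightarrow> bool" where
  "normalized_haar_measure G T \<mu> \<longleftrightarrow>
     radon_measure T \<mu> \<and> emeasure \<mu> (carrier G) = 1 \<and>
     (\<forall>\<sigma>\<in>carrier G. \<forall>A\<in>sets \<mu>. emeasure \<mu> (\<sigma> <#\<^bsub>G\<^esub> A) = emeasure \<mu> A)"

text \<open>The vertex set of a graph is the whole type; a graph is given by its edge set.\<close>

definition graph_edges :: "('v \<times> 'v) set \<Rightarrow> bool" where
  "graph_edges E \<longleftrightarrow> sym E \<and> irrefl E"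

definition independent_set :: "('v \<times> 'v) set \<Rightarrow> 'v set \<Rightarrow> bool" where
  "independent_set E I \<longleftrightarrow> (\<forall>x\<in>I. \<forall>y\<in>I. (x, y) \<notin> E)"

text \<open>Edges are preserved in both directions, so that the inverse of an automorphism is one.\<close>

definition aut_group :: "('v \<times> 'v) set \<Rightarrow> ('v \<Rightarrow> 'v) monoid" where
  "aut_group E =
     \<lparr>carrier = {\<sigma>. bij \<sigma> \<and> (\<forall>x y. (\<sigma> x, \<sigma> y) \<in> E \<longleftrightarrow> (x, y) \<in> E)}, mult = (\<circ>), one = id\<rparr>"

lemma group_aut_group: "group (aut_group E)"
proof (rule groupI)
  fix \<sigma> assume s: "\<sigma> \<in> carrier (aut_group E)"
  then have b: "bij \<sigma>" and e: "\<And>x y. (\<sigma> x, \<sigma> y) \<in> E \<longleftrightarrow> (x, y) \<in> E"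
    by (auto simp: aut_group_def)
  have r: "\<sigma> (inv_into UNIV \<sigma> x) = x" for x
    using b by (simp add: bij_is_surj surj_f_inv_f)
  have "(inv_into UNIV \<sigma> x, inv_into UNIV \<sigma> y) \<in> E \<longleftrightarrow> (x, y) \<in> E" for x y
    using e[of "inv_into UNIV \<sigma> x" "inv_into UNIV \<sigma> y"] r by simp
  then have "inv_into UNIV \<sigma> \<in> carrier (aut_group E)"
    using b by (simp add: aut_group_def bij_imp_bij_inv)
  moreover have "inv_into UNIV \<sigma> \<circ> \<sigma> = id"
    using b by (simp add: bij_is_inj)
  ultimately show "\<exists>\<tau>\<in>carrier (aut_group E). \<tau> \<otimes>\<^bsub>aut_group E\<^esub> \<sigma> = \<one>\<^bsub>aut_group E\<^esub>"
    by (auto simp: aut_group_def)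
qed (auto simp: aut_group_def bij_comp comp_assoc)

definition indep_ratio :: "('v::topological_space \<times> 'v) set \<Rightarrow> 'v measure \<Rightarrow> ereal" where
  "indep_ratio E \<omega> =
     (SUP I\<in>{I. independent_set E I \<and> I \<in> sets \<omega>}. enn2ereal (emeasure \<omega> I))"

definition quotient_topology :: "'a topology \<Rightarrow> ('a \<Rightarrow> 'b) \<Rightarrow> 'b topology" where
  "quotient_topology X q =
     topology (\<lambda>U. U \<subseteq> q ` topspace X \<and> openin X {x \<in> topspace X. q x \<in> U})"

lemma openin_quotient_topology:
  "openin (quotient_topology X q) U \<longleftrightarrow>
     U \<subseteq> q ` topspace X \<and> openin X {x \<in> topspace X. q x \<in> U}"
proof -
  have "istopology (\<lambda>U. U \<subseteq> q ` topspace X \<and> openin X {x \<in> topspace X. q x \<in> U})"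
    unfolding istopology_def
  proof (intro conjI allI impI; (elim conjE)?)
    fix S T
    assume "openin X {x \<in> topspace X. q x \<in> S}" "openin X {x \<in> topspace X. q x \<in> T}"
    then have "openin X ({x \<in> topspace X. q x \<in> S} \<inter> {x \<in> topspace X. q x \<in> T})"
      by blast
    also have "\<dots> = {x \<in> topspace X. q x \<in> S \<inter> T}"
      by blast
    finally show "openin X {x \<in> topspace X. q x \<in> S \<inter> T}" .
  next
    fix \<K> assume "\<forall>K\<in>\<K>. K \<subseteq> q ` topspace X \<and> openin X {x \<in> topspace X. q x \<in> K}"
    then have "openin X (\<Union>K\<in>\<K>. {x \<in> topspace X. q x \<in> K})"
      by blast
    also have "\<dots> = {x \<in> topspace X. q x \<in> \<Union>\<K>}"
      by blast
    finally show "openin X {x \<in> topspace X. q x \<in> \<Union>\<K>}" .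
  qed auto
  then show ?thesis
    by (simp add: quotient_topology_def)
qed

lemma quotient_map_quotient_topology: "quotient_map X (quotient_topology X q) q"
proof -
  have "{x \<in> topspace X. q x \<in> q ` topspace X} = topspace X"
    by blast
  then have "topspace (quotient_topology X q) = q ` topspace X"
    by (intro equalityI openin_subset) (auto simp: openin_quotient_topology topspace_def)
  then show ?thesis
    by (simp add: quotient_map_def openin_quotient_topology)
qed

definition Sub :: "nat \<Rightarrow> 'v set set" where
  "Sub k = {S. finite S \<and> card S \<le> k}"

text \<open>
  Elements of \<open>V\<^sup>k\<close> are extensional functions on \<open>{..<k}\<close>. A set of subsets is open if and only if
  its part in \<open>Sub k - {{}}\<close> is open, which makes \<open>{}\<close> an isolated point.
\<close>

definition Sub_topology :: "nat \<Rightarrow> 'v::topological_space set topology" where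
  "Sub_topology k =
     topology (\<lambda>W. W \<subseteq> Sub k \<and>
       openin (quotient_topology (product_topology (\<lambda>i. euclidean) {..<k}) (\<lambda>v. v ` {..<k}))
              (W - {{}}))"

lemma openin_Sub_topology:
  "openin (Sub_topology k) W \<longleftrightarrow> W \<subseteq> Sub k \<and>
     openin (quotient_topology (product_topology (\<lambda>i. euclidean) {..<k}) (\<lambda>v. v ` {..<k}))
            (W - {{}})"
proof -
  let ?Q = "quotient_topology (product_topology (\<lambda>i. euclidean) {..<k})
              (\<lambda>v. v ` {..<k} :: 'a set)"
  have "istopology (\<lambda>W. W \<subseteq> Sub k \<and> openin ?Q (W - {{}}))"
    unfolding istopology_def
  proof (intro conjI allI impI; (elim conjE)?)
    fix S T
    assume "openin ?Q (S - {{}})" "openin ?Q (T - {{}})"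
    then have "openin ?Q ((S - {{}}) \<inter> (T - {{}}))"
      by blast
    also have "(S - {{}}) \<inter> (T - {{}}) = S \<inter> T - {{}}"
      by blast
    finally show "openin ?Q (S \<inter> T - {{}})" .
  next
    fix \<K> assume "\<forall>K\<in>\<K>. K \<subseteq> Sub k \<and> openin ?Q (K - {{}})"
    then have "openin ?Q (\<Union>K\<in>\<K>. K - {{}})"
      by blast
    also have "(\<Union>K\<in>\<K>. K - {{}}) = \<Union>\<K> - {{}}"
      by blast
    finally show "openin ?Q (\<Union>\<K> - {{}})" .
  qed auto
  then show ?thesis
    by (simp add: Sub_topology_def)
qed

lemma topspace_Sub_topology: "topspace (Sub_topology k) = (Sub k :: 'v::topological_space set set)"
proof -
  let ?P = "product_topology (\<lambda>i. euclidean :: 'v topology) {..<k}"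
  have "S \<in> (\<lambda>v. v ` {..<k}) ` topspace ?P" if S: "S \<in> Sub k" "S \<noteq> {}" for S :: "'v set"
  proof -
    obtain n and g :: "nat \<Rightarrow> 'v" where g: "S = g ` {i. i < n}" "inj_on g {i. i < n}"
      using S finite_imp_nat_seg_image_inj_on[of S] by (auto simp: Sub_def)
    then have "n = card S"
      by (simp add: card_image)
    then have "n \<le> k" "0 < n"
      using S g(1) by (auto simp: Sub_def)
    have "S \<subseteq> (\<lambda>i\<in>{..<k}. if i < n then g i else g 0) ` {..<k}"
    proof
      fix x assume "x \<in> S"
      then obtain i where "i < n" "x = g i"
        using g(1) by blast
      then show "x \<in> (\<lambda>i\<in>{..<k}. if i < n then g i else g 0) ` {..<k}"
        using \<open>n \<le> k\<close> by (intro image_eqI[where x = i]) auto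
    qed
    moreover have "(\<lambda>i\<in>{..<k}. if i < n then g i else g 0) ` {..<k} \<subseteq> S"
      using g(1) \<open>0 < n\<close> by auto
    ultimately show ?thesis
      by (intro image_eqI[where x = "\<lambda>i\<in>{..<k}. if i < n then g i else g 0"]) auto
  qed
  then have surj: "Sub k - {{}} \<subseteq> (\<lambda>v. v ` {..<k}) ` topspace ?P"
    by blast
  have "v ` {..<k} \<in> Sub k" for v :: "nat \<Rightarrow> 'v"
    using card_image_le[of "{..<k}" v] by (simp add: Sub_def)
  then have "{v \<in> topspace ?P. v ` {..<k} \<in> Sub k - {{}}} = (if k = 0 then {} else topspace ?P)"
    by (auto simp: lessThan_empty_iff)
  then have "openin ?P {v \<in> topspace ?P. v ` {..<k} \<in> Sub k - {{}}}"
    by (simp only: openin_empty openin_topspace split: if_split) simp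
  with surj have "openin (Sub_topology k) (Sub k :: 'v set set)"
    unfolding openin_Sub_topology openin_quotient_topology by blast
  then have "Sub k \<subseteq> topspace (Sub_topology k :: 'v set topology)"
    by (rule openin_subset)
  moreover have "topspace (Sub_topology k :: 'v set topology) \<subseteq> Sub k"
    using openin_topspace openin_Sub_topology by blast
  ultimately show ?thesis
    by blast
qed

text \<open>
  Positive semidefiniteness is a property of continuous symmetric kernels. For the kernels below,
  continuity follows from that of \<open>\<nu>\<close> when the vertex space is compact Hausdorff.
\<close>

definition psd_kernel :: "'a topology \<Rightarrow> ('a \<Rightarrow> 'a \<Rightarrow> real) \<Rightarrow> bool" where
  "psd_kernel X K \<longleftrightarrow>
     continuous_map (prod_topology X X) euclideanreal (\<lambda>(x, y). K x y) \<and>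
     (\<forall>x\<in>topspace X. \<forall>y\<in>topspace X. K x y = K y x) \<and>
     (\<forall>U. finite U \<and> U \<subseteq> topspace X \<longrightarrow>
        (\<forall>c :: 'a \<Rightarrow> real. 0 \<le> (\<Sum>x\<in>U. \<Sum>y\<in>U. c x * c y * K x y)))"

definition lass_feasible :: "nat \<Rightarrow> ('v::topological_space \<times> 'v) set \<Rightarrow> ('v set \<Rightarrow> real) \<Rightarrow> bool" where
  "lass_feasible k E \<nu> \<longleftrightarrow>
     continuous_map (Sub_topology (2 * k)) euclideanreal \<nu> \<and>
     \<nu> {} = 1 \<and>
     (\<forall>S\<in>Sub (2 * k). \<not> independent_set E S \<longrightarrow> \<nu> S = 0) \<and>
     psd_kernel (Sub_topology k) (\<lambda>S T. \<nu> (S \<union> T))"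

text \<open>
  The suprema are taken in the extended reals, so that no boundedness is presupposed. For finite
  \<open>\<omega>\<close> on a compact vertex space the continuous integrands below are integrable.
\<close>

definition lass :: "nat \<Rightarrow> ('v::topological_space \<times> 'v) set \<Rightarrow> 'v measure \<Rightarrow> ereal" where
  "lass k E \<omega> = (SUP \<nu>\<in>{\<nu>. lass_feasible k E \<nu>}. ereal (\<integral>x. \<nu> {x} \<partial>\<omega>))"

definition k_point_feasible ::
    "nat \<Rightarrow> ('v::topological_space \<times> 'v) set \<Rightarrow> ('v set \<Rightarrow> real) \<Rightarrow> bool" where
  "k_point_feasible k E \<nu> \<longleftrightarrow>
     continuous_map (Sub_topology k) euclideanreal \<nu> \<and>
     \<nu> {} = 1 \<and>
     (\<forall>S\<in>Sub k. \<not> independent_set E S \<longrightarrow> \<nu> S = 0) \<and>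
     (\<forall>Q\<in>Sub (k - 2). independent_set E Q \<longrightarrow>
        psd_kernel (Sub_topology 1) (\<lambda>S T. \<nu> (Q \<union> S \<union> T)))"

definition k_point_bound :: "nat \<Rightarrow> ('v::topological_space \<times> 'v) set \<Rightarrow> 'v measure \<Rightarrow> ereal" where
  "k_point_bound k E \<omega> = (SUP \<nu>\<in>{\<nu>. k_point_feasible k E \<nu>}. ereal (\<integral>x. \<nu> {x} \<partial>\<omega>))"

end

theory Submission
  imports Defs
begin

text \<open>
  For an independent Borel set \<open>I\<close> put \<open>\<nu> S = \<mu> {\<sigma>. inv \<sigma> carries S into I}\<close>. The union of two sets
  corresponds to the intersection of the two events, so the moment kernels are Gram kernels. Regularity
  and left invariance of \<open>\<mu>\<close> make translation continuous in measure, and since orbit maps are open,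
  \<open>\<nu>\<close> is continuous. By transitivity \<open>\<nu> {x}\<close> does not depend on \<open>x\<close>; it equals \<open>\<omega> I\<close> because
  the Haar measure of a compact group is invariant under inversion, so that \<open>\<nu>\<close> has objective
  value \<open>\<omega> I\<close>.
\<close>

section \<open>Haar measure on a compact group: Borel sets, invariance, regularity\<close>

locale compact_haar = group G for G (structure) +
  fixes T :: "'a topology" and \<mu> :: "'a measure"
  assumes top_group: "topological_group G T"
    and compact: "compact_space T"
    and haar: "normalized_haar_measure G T \<mu>"
begin

lemma topspace_eq [simp]: "topspace T = carrier G"
  using top_group by (simp add: topological_group_def)

lemma sets_haar: "sets \<mu> = sigma_sets (carrier G) {U. openin T U}"
  using haar openin_subset[of T]
  by (subst sets_measure_of[symmetric])
     (auto simp: normalized_haar_measure_def radon_measure_def borel_of_def)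

lemma space_haar [simp]: "space \<mu> = carrier G"
proof -
  have "sets \<mu> = sets (borel_of T)"
    using haar by (simp add: normalized_haar_measure_def radon_measure_def)
  then have "space \<mu> = space (borel_of T)"
    by (rule sets_eq_imp_space_eq)
  also have "\<dots> = carrier G"
    using openin_subset[of T] by (subst borel_of_def, subst space_measure_of) auto
  finally show ?thesis .
qed

sublocale finite_measure \<mu>
  using haar by (intro finite_measureI) (simp add: normalized_haar_measure_def)

lemma measure_carrier [simp]: "measure \<mu> (carrier G) = 1"
  using haar by (simp add: normalized_haar_measure_def measure_def)

lemma open_in_sets: "openin T U \<Longrightarrow> U \<in> sets \<mu>"
  by (auto simp: sets_haar)

lemma closed_in_sets:
  assumes "closedin T K" shows "K \<in> sets \<mu>"
proof -
  have "space \<mu> - (carrier G - K) \<in> sets \<mu>"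
    using assms by (intro sets.compl_sets open_in_sets) (simp add: closedin_def)
  moreover have "space \<mu> - (carrier G - K) = K"
    using closedin_subset[OF assms] by auto
  ultimately show ?thesis by simp
qed

text \<open>The target is an abstract topology, so that the same fact serves translations and
  inversion, with values in \<open>T\<close>, and orbit maps, with values in the vertex
  space.\<close>

lemma continuous_vimage_sets:
  assumes "continuous_map T X f" "A \<in> sigma_sets (topspace X) {U. openin X U}"
  shows "{\<sigma> \<in> carrier G. f \<sigma> \<in> A} \<in> sets \<mu>"
proof -
  have "f \<in> measurable \<mu> (sigma (topspace X) {U. openin X U})"
  proof (rule measurable_sigma_sets)
    show "sets (sigma (topspace X) {U. openin X U}) = sigma_sets (topspace X) {U. openin X U}"
      by (rule sets_measure_of) (auto dest: openin_subset)
    show "f \<in> space \<mu> \<rightarrow> topspace X"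
      using assms(1) by (auto simp: continuous_map_def)
    fix U assume "U \<in> {U. openin X U}"
    then have "openin T {x \<in> topspace T. f x \<in> U}"
      using assms(1) by (simp add: continuous_map_def)
    moreover have "{x \<in> topspace T. f x \<in> U} = f -` U \<inter> space \<mu>"
      by auto
    ultimately show "f -` U \<inter> space \<mu> \<in> sets \<mu>"
      by (metis open_in_sets)
  qed (auto dest: openin_subset)
  moreover have "A \<in> sets (sigma (topspace X) {U. openin X U})"
    using assms(2) by (subst sets_measure_of) (auto dest: openin_subset)
  ultimately have "f -` A \<inter> space \<mu> \<in> sets \<mu>"
    by (rule measurable_sets)
  moreover have "f -` A \<inter> space \<mu> = {\<sigma> \<in> carrier G. f \<sigma> \<in> A}"
    by auto
  ultimately show ?thesis by simp
qed

lemma continuous_mult: "continuous_map (prod_topology T T) T (\<lambda>(\<sigma>, \<tau>). \<sigma> \<otimes> \<tau>)"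
  and continuous_inv: "continuous_map T T (m_inv G)"
  using top_group by (auto simp: topological_group_def)

lemma continuous_mult_fun:
  assumes "continuous_map X T f" "continuous_map X T g"
  shows "continuous_map X T (\<lambda>x. f x \<otimes> g x)"
proof -
  have "continuous_map X (prod_topology T T) (\<lambda>x. (f x, g x))"
    using assms by (simp add: continuous_map_pairwise o_def)
  from continuous_map_compose[OF this continuous_mult] show ?thesis
    by (simp add: o_def)
qed

lemma translate_sets:
  assumes "\<sigma> \<in> carrier G" "A \<in> sets \<mu>"
  shows "{\<tau> \<in> carrier G. \<sigma> \<otimes> \<tau> \<in> A} \<in> sets \<mu>"
proof (rule continuous_vimage_sets)
  show "continuous_map T T (\<lambda>\<tau>. \<sigma> \<otimes> \<tau>)"
    using assms(1) by (intro continuous_mult_fun) (simp_all flip: id_def)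
qed (use assms sets_haar in auto)

lemma inverse_sets: "A \<in> sets \<mu> \<Longrightarrow> {\<tau> \<in> carrier G. inv \<tau> \<in> A} \<in> sets \<mu>"
  using continuous_vimage_sets[OF continuous_inv] sets_haar by simp

text \<open>The preimage of \<open>A\<close> under left multiplication by \<open>\<sigma>\<close> is
  the coset \<open>inv \<sigma> <# A\<close>, so this is left invariance in preimage form.\<close>

lemma measure_translate:
  assumes "\<sigma> \<in> carrier G" "A \<in> sets \<mu>"
  shows "measure \<mu> {\<tau> \<in> carrier G. \<sigma> \<otimes> \<tau> \<in> A} = measure \<mu> A"
proof -
  have "A \<subseteq> carrier G"
    using assms(2) sets.sets_into_space by fastforce
  have "{\<tau> \<in> carrier G. \<sigma> \<otimes> \<tau> \<in> A} = inv \<sigma> <# A"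
  proof (intro equalityI subsetI)
    fix \<tau> assume "\<tau> \<in> {\<tau> \<in> carrier G. \<sigma> \<otimes> \<tau> \<in> A}"
    then have "\<tau> = inv \<sigma> \<otimes> (\<sigma> \<otimes> \<tau>)" "\<sigma> \<otimes> \<tau> \<in> A"
      using assms(1) by (simp_all flip: m_assoc)
    then show "\<tau> \<in> inv \<sigma> <# A"
      unfolding l_coset_def by blast
  qed (use \<open>A \<subseteq> carrier G\<close> assms(1) in \<open>auto simp: l_coset_def simp flip: m_assoc\<close>)
  then show ?thesis
    using haar assms by (simp add: normalized_haar_measure_def measure_def)
qed

lemma outer_regular:
  assumes "A \<in> sets \<mu>" "\<epsilon> > 0"
  obtains U where "openin T U" "A \<subseteq> U" "measure \<mu> U < measure \<mu> A + \<epsilon>"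
proof -
  have "emeasure \<mu> A = (INF U\<in>{U. openin T U \<and> A \<subseteq> U}. emeasure \<mu> U)"
    using haar assms(1) by (auto simp: normalized_haar_measure_def radon_measure_def)
  moreover have "emeasure \<mu> A < ennreal (measure \<mu> A + \<epsilon>)"
    using assms(2) by (simp add: emeasure_eq_measure ennreal_less_iff)
  ultimately obtain U where "openin T U" "A \<subseteq> U" "emeasure \<mu> U < ennreal (measure \<mu> A + \<epsilon>)"
    by (auto simp: INF_less_iff)
  then show ?thesis
    using that by (simp add: emeasure_eq_measure ennreal_less_iff)
qed

text \<open>The Radon property approximates from inside only for open sets. For a Borel set, take
  the complement of an open set that approximates the complement of \<open>A\<close> from outside;
  finiteness of \<open>\<mu>\<close> turns one error into the other.\<close>

lemma inner_regular:
  assumes "A \<in> sets \<mu>" "\<epsilon> > 0"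
  obtains K where "closedin T K" "K \<subseteq> A" "measure \<mu> A < measure \<mu> K + \<epsilon>"
proof -
  have A: "A \<subseteq> carrier G"
    using assms(1) sets.sets_into_space by fastforce
  have "carrier G - A \<in> sets \<mu>"
    using sets.compl_sets[OF assms(1)] by simp
  then obtain U where U: "openin T U" "carrier G - A \<subseteq> U"
    "measure \<mu> U < measure \<mu> (carrier G - A) + \<epsilon>"
    using outer_regular assms(2) by metis
  show ?thesis
  proof (rule that)
    show "closedin T (carrier G - U)"
      using U(1) by (metis closedin_diff closedin_topspace topspace_eq)
    show "carrier G - U \<subseteq> A"
      using U(2) by blast
    show "measure \<mu> A < measure \<mu> (carrier G - U) + \<epsilon>"
      using U(3) finite_measure_compl[OF open_in_sets[OF U(1)]] finite_measure_compl[OF assms(1)]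
      by simp
  qed
qed

section \<open>Uniform neighbourhoods of the identity and invariance under inversion\<close>

text \<open>The preimage of \<open>U\<close> under multiplication is open and contains
  \<open>{\<one>} \<times> K\<close>. As \<open>K\<close> is compact, the tube lemma yields one
  \<open>N\<close> that works for all points of \<open>K\<close> at once.\<close>

lemma closed_nhds_left:
  assumes "closedin T K" "openin T U" "K \<subseteq> U"
  obtains N where "openin T N" "\<one> \<in> N" "\<And>\<sigma> \<tau>. \<sigma> \<in> N \<Longrightarrow> \<tau> \<in> K \<Longrightarrow> \<sigma> \<otimes> \<tau> \<in> U"
proof -
  let ?W = "{p \<in> topspace (prod_topology T T). (\<lambda>(\<sigma>, \<tau>). \<sigma> \<otimes> \<tau>) p \<in> U}"
  have K: "K \<subseteq> carrier G"
    using closedin_subset[OF assms(1)] by simp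
  have "openin (prod_topology T T) ?W"
    using continuous_mult assms(2) by (rule openin_continuous_map_preimage)
  moreover have "compactin T K"
    using compact assms(1) by (rule closedin_compact_space)
  moreover have "{\<one>} \<times> K \<subseteq> ?W"
    using assms(3) K by (auto simp: subset_iff)
  ultimately obtain N V where "openin T N" "\<one> \<in> N" "K \<subseteq> V" "N \<times> V \<subseteq> ?W"
    using tube_lemma_right[of T T ?W K \<one>] by auto
  then show ?thesis
    by (intro that[of N]) (auto simp: subset_iff)
qed

lemma closed_nhds_right:
  assumes "closedin T K" "openin T U" "K \<subseteq> U"
  obtains N where "openin T N" "\<one> \<in> N" "\<And>\<sigma> \<tau>. \<sigma> \<in> N \<Longrightarrow> \<tau> \<in> K \<Longrightarrow> \<tau> \<otimes> \<sigma> \<in> U"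
proof -
  let ?W = "{p \<in> topspace (prod_topology T T). (\<lambda>(\<sigma>, \<tau>). \<sigma> \<otimes> \<tau>) p \<in> U}"
  have K: "K \<subseteq> carrier G"
    using closedin_subset[OF assms(1)] by simp
  have "openin (prod_topology T T) ?W"
    using continuous_mult assms(2) by (rule openin_continuous_map_preimage)
  moreover have "compactin T K"
    using compact assms(1) by (rule closedin_compact_space)
  moreover have "K \<times> {\<one>} \<subseteq> ?W"
    using assms(3) K by (auto simp: subset_iff)
  ultimately obtain V N where "openin T N" "\<one> \<in> N" "K \<subseteq> V" "V \<times> N \<subseteq> ?W"
    using tube_lemma_left[of T T ?W K \<one>] by auto
  then show ?thesis
    by (intro that[of N]) (auto simp: subset_iff)
qed

text \<open>
  Cutting \<open>carrier G\<close> into small pieces \<open>B i\<close> near points \<open>h i\<close> gives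
  \<open>\<mu> K = \<mu> {\<tau>. \<sigma> \<otimes> \<tau> \<in> K} \<le> (\<Sum>i<n. \<mu> (B i) * indicator U (\<sigma> \<otimes> h i))\<close> for every \<open>\<sigma>\<close>.
  Integrating over \<open>inv \<sigma>\<close> replaces every indicator by the measure of the inverse of \<open>U\<close>.
\<close>

lemma measure_closed_le_inverse_open:
  assumes K: "closedin T K" and U: "openin T U" and "K \<subseteq> U"
  shows "measure \<mu> K \<le> measure \<mu> {\<sigma> \<in> carrier G. inv \<sigma> \<in> U}"
proof -
  obtain N where N: "openin T N" "\<one> \<in> N" "\<And>\<sigma> \<tau>. \<sigma> \<in> N \<Longrightarrow> \<tau> \<in> K \<Longrightarrow> \<tau> \<otimes> \<sigma> \<in> U"
    using closed_nhds_right[OF assms] by metis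
  \<comment> \<open>\<open>O' t\<close> consists of the points from which \<open>t\<close> is
    reached by a right factor in \<open>N\<close>, since
    \<open>t = \<tau> \<otimes> (inv \<tau> \<otimes> t)\<close>. These sets cover the group because
    \<open>\<one> \<in> N\<close>.\<close>
  define O' where "O' t = {\<tau> \<in> carrier G. inv \<tau> \<otimes> t \<in> N}" for t
  have O'_open: "openin T (O' t)" if "t \<in> carrier G" for t
  proof -
    have "continuous_map T T (\<lambda>\<tau>. inv \<tau> \<otimes> t)"
      using that by (intro continuous_mult_fun continuous_inv) simp
    from openin_continuous_map_preimage[OF this N(1)] show ?thesis
      by (simp add: O'_def)
  qed
  have "compactin T (carrier G)"
    using compact by (simp add: compact_space_def)
  moreover have "carrier G \<subseteq> \<Union>(O' ` carrier G)"
    using N(2) by (auto simp: O'_def)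
  ultimately obtain \<F> where "finite \<F>" "\<F> \<subseteq> O' ` carrier G" "carrier G \<subseteq> \<Union>\<F>"
    using O'_open unfolding compactin_def by (metis (no_types, lifting) imageE)
  then obtain F where F: "finite F" "F \<subseteq> carrier G" "carrier G \<subseteq> \<Union>(O' ` F)"
    by (metis finite_subset_image)
  obtain h and n :: nat where h: "F = h ` {..<n}"
    using F(1) by (metis finite_imp_nat_seg_image_inj_on lessThan_def)
  have hG: "h i \<in> carrier G" if "i < n" for i
    using that h F(2) by auto
  \<comment> \<open>Removing what earlier sets cover makes the finite cover a measurable partition;
    each point lies in the piece of the first index whose \<open>O'\<close> contains it.\<close>
  define B where "B i = O' (h i) - (\<Union>j<i. O' (h j))" for i
  have O'_sets: "O' (h i) \<in> sets \<mu>" if "i < n" for i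
    using that hG O'_open open_in_sets by blast
  have B_sets: "B i \<in> sets \<mu>" if "i < n" for i
    unfolding B_def using that O'_sets by (intro sets.Diff sets.finite_UN) auto
  have B_disj: "disjoint_family_on B {..<n}"
  proof -
    have "B i \<inter> B j = {}" if "i < j" for i j
      using that by (auto simp: B_def)
    then show ?thesis
      by (auto simp: disjoint_family_on_def) (metis IntI empty_iff nat_neq_iff)
  qed
  have B_UN: "(\<Union>i<n. B i) = carrier G"
  proof
    show "(\<Union>i<n. B i) \<subseteq> carrier G"
      by (auto simp: B_def O'_def)
    show "carrier G \<subseteq> (\<Union>i<n. B i)"
    proof
      fix \<tau> assume "\<tau> \<in> carrier G"
      then obtain i where i: "i < n" "\<tau> \<in> O' (h i)"
        using F(3) h by auto
      define j where "j = (LEAST j. \<tau> \<in> O' (h j))"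
      have "\<tau> \<in> O' (h j)" "j \<le> i"
        using i(2) by (auto simp: j_def intro: LeastI Least_le)
      moreover have "\<tau> \<notin> O' (h l)" if "l < j" for l
        using that not_less_Least unfolding j_def by blast
      ultimately show "\<tau> \<in> (\<Union>i<n. B i)"
        using i(1) by (auto simp: B_def)
    qed
  qed
  have meas_U: "{\<sigma> \<in> carrier G. inv \<sigma> \<in> U} \<in> sets \<mu>"
    using inverse_sets open_in_sets U by blast
  \<comment> \<open>Since \<open>inv \<sigma> \<otimes> h i\<close> is the inverse of
    \<open>inv (h i) \<otimes> \<sigma>\<close>, the set \<open>D i\<close> is a left translate of
    the inverse of \<open>U\<close>, and its measure does not depend on \<open>i\<close>.\<close>
  define D where "D i = {\<sigma> \<in> carrier G. inv \<sigma> \<otimes> h i \<in> U}" for i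
  have D: "D i \<in> sets \<mu> \<and> measure \<mu> (D i) = measure \<mu> {\<sigma> \<in> carrier G. inv \<sigma> \<in> U}"
    if "i < n" for i
  proof -
    have "D i = {\<sigma> \<in> carrier G. inv (h i) \<otimes> \<sigma> \<in> {\<sigma> \<in> carrier G. inv \<sigma> \<in> U}}"
      using hG[OF that] by (auto simp: D_def inv_mult_group)
    then show ?thesis
      using translate_sets[OF _ meas_U] measure_translate[OF _ meas_U] hG[OF that] by simp
  qed
  have le: "measure \<mu> K \<le> (\<Sum>i<n. measure \<mu> (B i) * indicator (D i) \<sigma>)"
    if \<sigma>: "\<sigma> \<in> carrier G" for \<sigma>
  proof -
    let ?L = "{\<tau> \<in> carrier G. inv \<sigma> \<otimes> \<tau> \<in> K}"
    have L: "?L \<in> sets \<mu>"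
      using \<sigma> translate_sets closed_in_sets[OF K] by simp
    have "measure \<mu> K = measure \<mu> ?L"
      using \<sigma> measure_translate closed_in_sets[OF K] by simp
    also have "?L = (\<Union>i<n. ?L \<inter> B i)"
      using B_UN by auto
    also have "measure \<mu> \<dots> = (\<Sum>i<n. measure \<mu> (?L \<inter> B i))"
      using L B_sets B_disj
      by (intro finite_measure_finite_Union) (auto simp: disjoint_family_on_def)
    also have "\<dots> \<le> (\<Sum>i<n. measure \<mu> (B i) * indicator (D i) \<sigma>)"
    proof (rule sum_mono)
      fix i assume "i \<in> {..<n}"
      then have i: "i < n" by simp
      show "measure \<mu> (?L \<inter> B i) \<le> measure \<mu> (B i) * indicator (D i) \<sigma>"
      proof (cases "?L \<inter> B i = {}")
        case False
        then obtain \<tau> where \<tau>: "\<tau> \<in> carrier G" "inv \<sigma> \<otimes> \<tau> \<in> K" "\<tau> \<in> B i"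
          by auto
        \<comment> \<open>Passing from \<open>\<tau>\<close> to \<open>h i\<close> is right
          multiplication by an element of \<open>N\<close>, which moves
          \<open>inv \<sigma> \<otimes> \<tau>\<close> from \<open>K\<close> into
          \<open>U\<close>.\<close>
        have "inv \<tau> \<otimes> h i \<in> N"
          using \<tau>(3) by (simp add: B_def O'_def)
        then have "(inv \<sigma> \<otimes> \<tau>) \<otimes> (inv \<tau> \<otimes> h i) \<in> U"
          using \<tau>(2) N(3) by blast
        also have "(inv \<sigma> \<otimes> \<tau>) \<otimes> (inv \<tau> \<otimes> h i) = inv \<sigma> \<otimes> h i"
          using \<sigma> \<tau>(1) hG[OF i] by (metis inv_closed inv_solve_left m_assoc m_closed)
        finally have "\<sigma> \<in> D i"
          using \<sigma> by (simp add: D_def)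
        then show ?thesis
          using B_sets[OF i] by (auto intro: finite_measure_mono)
      qed simp
    qed
    finally show ?thesis .
  qed
  have "measure \<mu> K = (\<integral>\<sigma>. measure \<mu> K \<partial>\<mu>)"
    by simp
  also have "\<dots> \<le> (\<integral>\<sigma>. (\<Sum>i<n. measure \<mu> (B i) * indicator (D i) \<sigma>) \<partial>\<mu>)"
    using le D
    by (intro integral_mono Bochner_Integration.integrable_sum integrable_mult_right
        integrable_real_indicator) (auto simp: less_top[symmetric])
  also have "\<dots> = (\<Sum>i<n. measure \<mu> (B i) * measure \<mu> (D i))"
  proof (subst Bochner_Integration.integral_sum)
    fix i assume "i \<in> {..<n}"
    then show "integrable \<mu> (\<lambda>\<sigma>. measure \<mu> (B i) * indicator (D i) \<sigma>)"
      using D by (intro integrable_mult_right integrable_real_indicator) (auto simp: less_top[symmetric])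
  next
    have "D i \<inter> carrier G = D i" for i
      by (auto simp: D_def)
    then show "(\<Sum>i<n. \<integral>\<sigma>. measure \<mu> (B i) * indicator (D i) \<sigma> \<partial>\<mu>) =
        (\<Sum>i<n. measure \<mu> (B i) * measure \<mu> (D i))"
      by simp
  qed
  also have "\<dots> = (\<Sum>i<n. measure \<mu> (B i)) * measure \<mu> {\<sigma> \<in> carrier G. inv \<sigma> \<in> U}"
    using D by (simp add: sum_distrib_right)
  also have "(\<Sum>i<n. measure \<mu> (B i)) = 1"
    using finite_measure_finite_Union[of "{..<n}" B] B_sets B_disj B_UN by auto
  finally show ?thesis by simp
qed

text \<open>Inversion \<open>J\<close> is an involution, so one inequality, applied to both
  \<open>A\<close> and \<open>J A\<close>, suffices. It holds for closed sets by comparison with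
  open sets around their inverses, and passes to Borel sets by inner regularity.\<close>

lemma measure_inverse:
  assumes "A \<in> sets \<mu>"
  shows "measure \<mu> {\<sigma> \<in> carrier G. inv \<sigma> \<in> A} = measure \<mu> A"
proof -
  define J where "J A = {\<sigma> \<in> carrier G. inv \<sigma> \<in> A}" for A
  have J_sets: "J A \<in> sets \<mu>" if "A \<in> sets \<mu>" for A
    using that inverse_sets by (simp add: J_def)
  have J_J: "J (J A) = A" if "A \<in> sets \<mu>" for A
    using sets.sets_into_space[OF that] by (auto simp: J_def)
  have closed: "measure \<mu> K \<le> measure \<mu> (J K)" if K: "closedin T K" for K
  proof (rule field_le_epsilon)
    fix \<epsilon> :: real assume "\<epsilon> > 0"
    then obtain U where U: "openin T U" "J K \<subseteq> U" "measure \<mu> U < measure \<mu> (J K) + \<epsilon>"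
      using outer_regular J_sets closed_in_sets[OF K] by metis
    have "openin T (J U)"
      using openin_continuous_map_preimage[OF continuous_inv U(1)] by (simp add: J_def)
    moreover have "K \<subseteq> J U"
    proof
      fix \<sigma> assume "\<sigma> \<in> K"
      moreover from this have "\<sigma> \<in> carrier G"
        using closedin_subset[OF K] by auto
      ultimately have "inv \<sigma> \<in> J K"
        by (simp add: J_def)
      then show "\<sigma> \<in> J U"
        using U(2) \<open>\<sigma> \<in> carrier G\<close> by (auto simp: J_def)
    qed
    \<comment> \<open>The open set around \<open>K\<close> is \<open>J U\<close>, whose inverse is
      \<open>U\<close> again, and \<open>U\<close> is only slightly larger than
      \<open>J K\<close>.\<close>
    ultimately have "measure \<mu> K \<le> measure \<mu> (J (J U))"
      unfolding J_def by (rule measure_closed_le_inverse_open[OF K])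
    then show "measure \<mu> K \<le> measure \<mu> (J K) + \<epsilon>"
      using U(3) J_J[OF open_in_sets[OF U(1)]] by simp
  qed
  have le: "measure \<mu> A \<le> measure \<mu> (J A)" if A: "A \<in> sets \<mu>" for A
  proof (rule field_le_epsilon)
    fix \<epsilon> :: real assume "\<epsilon> > 0"
    then obtain K where K: "closedin T K" "K \<subseteq> A" "measure \<mu> A < measure \<mu> K + \<epsilon>"
      using inner_regular A by metis
    have "measure \<mu> (J K) \<le> measure \<mu> (J A)"
      using K(2) J_sets[OF A] by (intro finite_measure_mono) (auto simp: J_def)
    then show "measure \<mu> A \<le> measure \<mu> (J A) + \<epsilon>"
      using K closed[OF K(1)] by simp
  qed
  show ?thesis
    using le[OF assms] le[OF J_sets[OF assms]] J_J[OF assms] by (simp add: J_def)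
qed

section \<open>Continuity of translation in measure\<close>

text \<open>Squeeze \<open>K \<subseteq> B \<subseteq> U\<close> with \<open>K\<close> closed,
  \<open>U\<close> open and both gaps below \<open>\<epsilon> / 2\<close>. Group elements near
  \<open>\<one>\<close> carry all of \<open>K\<close> into \<open>U\<close>, so only the two gaps
  contribute.\<close>

lemma translation_continuous:
  assumes B: "B \<in> sets \<mu>" and "\<epsilon> > 0"
  obtains N where "openin T N" "\<one> \<in> N"
    "\<And>\<sigma>. \<sigma> \<in> N \<Longrightarrow> measure \<mu> (B - {\<tau> \<in> carrier G. \<sigma> \<otimes> \<tau> \<in> B}) < \<epsilon>"
    "\<And>\<sigma>. \<sigma> \<in> N \<Longrightarrow> measure \<mu> ({\<tau> \<in> carrier G. \<sigma> \<otimes> \<tau> \<in> B} - B) < \<epsilon>"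
proof -
  have "\<epsilon> / 2 > 0"
    using assms(2) by simp
  obtain U where U: "openin T U" "B \<subseteq> U" "measure \<mu> U < measure \<mu> B + \<epsilon> / 2"
    using outer_regular[OF B \<open>\<epsilon> / 2 > 0\<close>] by metis
  obtain K where K: "closedin T K" "K \<subseteq> B" "measure \<mu> B < measure \<mu> K + \<epsilon> / 2"
    using inner_regular[OF B \<open>\<epsilon> / 2 > 0\<close>] by metis
  obtain N where N: "openin T N" "\<one> \<in> N" "\<And>\<sigma> \<tau>. \<sigma> \<in> N \<Longrightarrow> \<tau> \<in> K \<Longrightarrow> \<sigma> \<otimes> \<tau> \<in> U"
    using closed_nhds_left[OF K(1) U(1)] K(2) U(2) by (metis subset_trans)
  have BG: "B \<subseteq> carrier G" and KG: "K \<subseteq> carrier G"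
    using sets.sets_into_space[OF B] K(2) by auto
  have main: "measure \<mu> (B - {\<tau> \<in> carrier G. \<sigma> \<otimes> \<tau> \<in> B}) < \<epsilon>" if "\<sigma> \<in> N" for \<sigma>
  proof -
    have \<sigma>: "\<sigma> \<in> carrier G"
      using that openin_subset[OF N(1)] by auto
    let ?P = "\<lambda>A. {\<tau> \<in> carrier G. \<sigma> \<otimes> \<tau> \<in> A}"
    have "B - K \<in> sets \<mu>" "U - B \<in> sets \<mu>"
      using B closed_in_sets[OF K(1)] open_in_sets[OF U(1)] by auto
    note sets = this translate_sets[OF \<sigma> this(2)]
    \<comment> \<open>A point of \<open>K\<close> is carried into \<open>U\<close>; if it leaves
      \<open>B\<close>, it lands in \<open>U - B\<close>.\<close>
    have "B - ?P B \<subseteq> (B - K) \<union> ?P (U - B)"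
      using N(3)[OF that] KG BG by auto
    then have "measure \<mu> (B - ?P B) \<le> measure \<mu> ((B - K) \<union> ?P (U - B))"
      using sets by (intro finite_measure_mono) auto
    also have "\<dots> \<le> measure \<mu> (B - K) + measure \<mu> (?P (U - B))"
      using sets by (intro measure_Un_le) auto
    also have "\<dots> = (measure \<mu> B - measure \<mu> K) + (measure \<mu> U - measure \<mu> B)"
      unfolding measure_translate[OF \<sigma> sets(2)]
      using B closed_in_sets[OF K(1)] open_in_sets[OF U(1)] K(2) U(2)
      by (simp add: finite_measure_Diff)
    also have "\<dots> < \<epsilon>"
      using K(3) U(3) by simp
    finally show ?thesis .
  qed
  show ?thesis
  proof (rule that[OF N(1,2) main])
    fix \<sigma> assume \<sigma>: "\<sigma> \<in> N"
    then have sG: "\<sigma> \<in> carrier G"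
      using openin_subset[OF N(1)] by auto
    let ?P = "{\<tau> \<in> carrier G. \<sigma> \<otimes> \<tau> \<in> B}"
    have P: "?P \<in> sets \<mu>" "measure \<mu> ?P = measure \<mu> B"
      using translate_sets[OF sG B] measure_translate[OF sG B] by auto
    \<comment> \<open>Two sets of equal finite measure have differences of equal measure, so the
      first bound gives the second.\<close>
    then have "measure \<mu> (?P - B) = measure \<mu> (B - ?P)"
      using B finite_measure_Diff'[of ?P B] finite_measure_Diff'[of B ?P]
      by (simp add: Int_commute)
    then show "measure \<mu> (?P - B) < \<epsilon>"
      using main[OF \<sigma>] by simp
  qed
qed

end

section \<open>Tools: an epsilon criterion, Gram kernels and the topology of
  \<open>Sub k\<close>\<close>

lemma continuous_map_real_epsilonI:
  assumes "\<And>x \<epsilon>. x \<in> topspace X \<Longrightarrow> \<epsilon> > 0 \<Longrightarrow>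
    \<exists>U. openin X U \<and> x \<in> U \<and> (\<forall>y\<in>U. \<bar>f y - f x\<bar> < (\<epsilon>::real))"
  shows "continuous_map X euclideanreal f"
  unfolding continuous_map_def
proof (intro conjI allI impI)
  fix V :: "real set" assume "openin euclideanreal V"
  show "openin X {x \<in> topspace X. f x \<in> V}"
  proof (subst openin_subopen, intro ballI)
    fix x assume x: "x \<in> {x \<in> topspace X. f x \<in> V}"
    then obtain \<epsilon> where "\<epsilon> > 0" "\<And>z. \<bar>z - f x\<bar> < \<epsilon> \<Longrightarrow> z \<in> V"
      using \<open>openin euclideanreal V\<close> by (auto simp: open_dist dist_real_def)
    moreover obtain U where "openin X U" "x \<in> U" "\<forall>y\<in>U. \<bar>f y - f x\<bar> < \<epsilon>"
      using assms[of x \<epsilon>] x \<open>\<epsilon> > 0\<close> by auto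
    ultimately show "\<exists>U. openin X U \<and> x \<in> U \<and> U \<subseteq> {x \<in> topspace X. f x \<in> V}"
      using openin_subset[of X U] by (intro exI[of _ U]) auto
  qed
qed auto

text \<open>The double sum is the integral of the square of the sum of
  \<open>c x * indicator (C \<inter> A x)\<close> over \<open>x \<in> U\<close>. The common factor
  \<open>C\<close> makes room for the event of a fixed set \<open>Q\<close> in the
  \<open>k\<close>-point kernels.\<close>

lemma (in finite_measure) gram_measure_nonneg:
  assumes "finite U" "C \<in> sets M" "\<And>x. x \<in> U \<Longrightarrow> A x \<in> sets M"
  shows "0 \<le> (\<Sum>x\<in>U. \<Sum>y\<in>U. c x * c y * measure M (C \<inter> A x \<inter> A y))"
proof -
  have int: "integrable M (\<lambda>w. c x * c y * indicator (C \<inter> A x \<inter> A y) w :: real)"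
    if "x \<in> U" "y \<in> U" for x y
    using assms that
    by (intro integrable_mult_right integrable_real_indicator) (auto simp: less_top[symmetric])
  have "0 \<le> (\<integral>w. (\<Sum>x\<in>U. c x * indicator (C \<inter> A x) w)\<^sup>2 \<partial>M)"
    by (intro Bochner_Integration.integral_nonneg) simp
  also have "(\<lambda>w. (\<Sum>x\<in>U. c x * indicator (C \<inter> A x) w)\<^sup>2) =
      (\<lambda>w. \<Sum>x\<in>U. \<Sum>y\<in>U. c x * c y * indicator (C \<inter> A x \<inter> A y) w)"
    by (auto simp: power2_eq_square sum_product indicator_def fun_eq_iff intro!: sum.cong)
  also have "(\<integral>w. (\<Sum>x\<in>U. \<Sum>y\<in>U. c x * c y * indicator (C \<inter> A x \<inter> A y) w) \<partial>M) =
      (\<Sum>x\<in>U. \<integral>w. (\<Sum>y\<in>U. c x * c y * indicator (C \<inter> A x \<inter> A y) w) \<partial>M)"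
    using int by (intro Bochner_Integration.integral_sum Bochner_Integration.integrable_sum)
  also have "\<dots> = (\<Sum>x\<in>U. \<Sum>y\<in>U. c x * c y * measure M (C \<inter> A x \<inter> A y))"
  proof (rule sum.cong[OF refl])
    fix x assume x: "x \<in> U"
    have "(\<integral>w. (\<Sum>y\<in>U. c x * c y * indicator (C \<inter> A x \<inter> A y) w) \<partial>M) =
        (\<Sum>y\<in>U. \<integral>w. c x * c y * indicator (C \<inter> A x \<inter> A y) w \<partial>M)"
      using int[OF x] by (rule Bochner_Integration.integral_sum)
    also have "\<dots> = (\<Sum>y\<in>U. c x * c y * measure M (C \<inter> A x \<inter> A y))"
    proof (rule sum.cong[OF refl])
      fix y assume "y \<in> U"
      then have "C \<inter> A x \<inter> A y \<inter> space M = C \<inter> A x \<inter> A y"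
        using assms(2) sets.sets_into_space by blast
      then show "(\<integral>w. c x * c y * indicator (C \<inter> A x \<inter> A y) w \<partial>M) =
          c x * c y * measure M (C \<inter> A x \<inter> A y)"
        by simp
    qed
    finally show "(\<integral>w. (\<Sum>y\<in>U. c x * c y * indicator (C \<inter> A x \<inter> A y) w) \<partial>M) =
        (\<Sum>y\<in>U. c x * c y * measure M (C \<inter> A x \<inter> A y))" .
  qed
  finally show ?thesis .
qed

text \<open>These are the basic sets of the Vietoris topology. Pulled back to \<open>V^k\<close>,
  membership says that every coordinate lies in the union and that each \<open>U\<close> contains
  some coordinate, which is a finite combination of open coordinate conditions.\<close>

lemma openin_Sub_vietoris:
  fixes \<U> :: "'v::topological_space set set"
  assumes "finite \<U>" "\<And>U. U \<in> \<U> \<Longrightarrow> open U"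
  shows "openin (Sub_topology k) {S \<in> Sub k. S \<subseteq> \<Union>\<U> \<and> (\<forall>U\<in>\<U>. S \<inter> U \<noteq> {})}"
proof -
  let ?P = "product_topology (\<lambda>i. euclidean :: 'v topology) {..<k}"
  let ?q = "\<lambda>v. v ` {..<k} :: 'v set"
  let ?W = "{S \<in> Sub k. S \<subseteq> \<Union>\<U> \<and> (\<forall>U\<in>\<U>. S \<inter> U \<noteq> {})}"
  \<comment> \<open>Openness of the whole space already contains the fact that every nonempty member
    of \<open>Sub k\<close> is the image of a tuple.\<close>
  have "openin (quotient_topology ?P ?q) (Sub k - {{}})"
    using openin_topspace[of "Sub_topology k :: 'v set topology"]
    by (simp only: topspace_Sub_topology openin_Sub_topology)
  then have surj: "Sub k - {{}} \<subseteq> ?q ` topspace ?P"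
    by (simp add: openin_quotient_topology)
  have coord: "openin ?P {v \<in> topspace ?P. v i \<in> U}" if "i < k" "open U" for i U
    using that by (intro openin_continuous_map_preimage[OF continuous_map_product_projection]) auto
  have q_Sub: "?q v \<in> Sub k" for v
    using card_image_le[of "{..<k}" v] by (simp add: Sub_def)
  have "openin ?P {v \<in> topspace ?P. ?q v \<in> ?W - {{}}}"
  proof (cases "k = 0")
    case True
    then have empty: "{v \<in> topspace ?P. ?q v \<in> ?W - {{}}} = {}"
      by auto
    show ?thesis
      unfolding empty by simp
  next
    case False
    \<comment> \<open>For \<open>k > 0\<close> the image of a tuple is never empty, so removing
      \<open>{}\<close> changes nothing. The trailing \<open>topspace ?P\<close> keeps the second
      factor open when \<open>\<U>\<close> is empty and its intersection is
      \<open>UNIV\<close>.\<close>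
    have eq: "{v \<in> topspace ?P. ?q v \<in> ?W - {{}}} =
        (\<Inter>i<k. {v \<in> topspace ?P. v i \<in> \<Union>\<U>}) \<inter>
        ((\<Inter>U\<in>\<U>. \<Union>i<k. {v \<in> topspace ?P. v i \<in> U}) \<inter> topspace ?P)"
      using False q_Sub by (auto simp: image_subset_iff) blast+
    have "openin ?P (\<Inter>i<k. {v \<in> topspace ?P. v i \<in> \<Union>\<U>})"
      using False assms(2) by (intro openin_INT2 coord open_Union) auto
    moreover have "openin ?P ((\<Inter>U\<in>\<U>. \<Union>i<k. {v \<in> topspace ?P. v i \<in> U}) \<inter> topspace ?P)"
    proof (intro openin_INT[OF assms(1)] openin_Union)
      fix U Z
      assume "U \<in> \<U>" "Z \<in> (\<lambda>i. {v \<in> topspace ?P. v i \<in> U}) ` {..<k}"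
      then show "openin ?P Z"
        using coord assms(2) by blast
    qed
    ultimately show ?thesis
      unfolding eq by (rule openin_Int)
  qed
  moreover have "?W - {{}} \<subseteq> ?q ` topspace ?P"
    using surj by blast
  ultimately show ?thesis
    by (simp add: openin_Sub_topology openin_quotient_topology)
qed

section \<open>Events attached to vertex sets in a homogeneous space\<close>

locale compact_homogeneous = compact_haar G T \<mu>
  for G (structure) and T :: "'a topology" and \<mu> :: "'a measure" +
  fixes \<phi> :: "'a \<Rightarrow> 'v::topological_space \<Rightarrow> 'v" and I :: "'v set"
  assumes homogeneous: "homogeneous_space G T euclidean \<phi>"
    and I_borel: "I \<in> sets borel"
begin

text \<open>The inverse makes moving a vertex by \<open>\<sigma>\<close> translate its event on the
  left, which is the side on which \<open>\<mu>\<close> is invariant by definition.\<close>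

definition inside :: "'v set \<Rightarrow> 'a set" where
  "inside S = {\<sigma> \<in> carrier G. \<forall>x\<in>S. \<phi> (inv \<sigma>) x \<in> I}"

lemma inside_empty: "inside {} = carrier G"
  by (simp add: inside_def)

lemma inside_Un: "inside (S \<union> S') = inside S \<inter> inside S'"
  by (auto simp: inside_def)

lemma action_mult:
  "\<sigma> \<in> carrier G \<Longrightarrow> \<tau> \<in> carrier G \<Longrightarrow> \<phi> \<sigma> (\<phi> \<tau> x) = \<phi> (\<sigma> \<otimes> \<tau>) x"
  using homogeneous by (simp add: homogeneous_space_def continuous_action_def)

lemma transitive:
  obtains \<sigma> where "\<sigma> \<in> carrier G" "\<phi> \<sigma> x = y"
  using homogeneous unfolding homogeneous_space_def by (metis UNIV_I topspace_euclidean)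

text \<open>Transitivity gives some \<open>\<sigma>\<close> with
  \<open>\<phi> \<sigma> x = x\<close>; applying \<open>\<one>\<close> to both sides and composing
  yields the claim.\<close>

lemma action_one: "\<phi> \<one> x = x"
proof -
  obtain \<sigma> where "\<sigma> \<in> carrier G" "\<phi> \<sigma> x = x"
    using transitive by metis
  then show ?thesis
    using action_mult[of "\<one>" \<sigma> x] by simp
qed

lemma continuous_orbit: "continuous_map T euclidean (\<lambda>\<sigma>. \<phi> \<sigma> x)"
proof -
  have "continuous_map T (prod_topology T euclidean) (\<lambda>\<sigma>. (\<sigma>, x))"
    by (simp add: continuous_map_pairwise o_def)
  moreover have "continuous_map (prod_topology T euclidean) euclidean (\<lambda>(\<sigma>, x). \<phi> \<sigma> x)"
    using homogeneous by (simp add: homogeneous_space_def continuous_action_def)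
  ultimately have "continuous_map T euclidean ((\<lambda>(\<sigma>, x). \<phi> \<sigma> x) \<circ> (\<lambda>\<sigma>. (\<sigma>, x)))"
    by (rule continuous_map_compose)
  then show ?thesis
    by (simp add: o_def)
qed

lemma orbit_vimage_sets: "{\<sigma> \<in> carrier G. \<phi> \<sigma> x \<in> I} \<in> sets \<mu>"
  using I_borel by (intro continuous_vimage_sets[OF continuous_orbit]) (simp add: sets_borel)

lemma inside_singleton: "inside {x} = {\<sigma> \<in> carrier G. inv \<sigma> \<in> {\<sigma> \<in> carrier G. \<phi> \<sigma> x \<in> I}}"
  by (auto simp: inside_def)

lemma inside_singleton_sets: "inside {x} \<in> sets \<mu>"
  unfolding inside_singleton by (rule inverse_sets[OF orbit_vimage_sets])

lemma inside_sets: "finite S \<Longrightarrow> inside S \<in> sets \<mu>"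
proof (induction S rule: finite_induct)
  case empty
  show ?case
    using sets.top[of \<mu>] by (simp add: inside_empty)
next
  case (insert x S)
  have "inside (insert x S) = inside {x} \<inter> inside S"
    using inside_Un[of "{x}" S] by simp
  then show ?case
    using insert.IH inside_singleton_sets by simp
qed

lemma inside_translate:
  assumes "\<sigma> \<in> carrier G"
  shows "inside {\<phi> \<sigma> x} = {\<tau> \<in> carrier G. inv \<sigma> \<otimes> \<tau> \<in> inside {x}}"
  using assms by (auto simp: inside_def action_mult inv_mult_group)

text \<open>Transitivity and left invariance move \<open>x\<close> to \<open>e\<close>; invariance
  under inversion then replaces \<open>inv \<sigma>\<close> by \<open>\<sigma>\<close>. The
  right-hand side is the pushforward measure of \<open>I\<close> with base point
  \<open>e\<close>.\<close>

lemma measure_inside_singleton: "measure \<mu> (inside {x}) = measure \<mu> {\<sigma> \<in> carrier G. \<phi> \<sigma> e \<in> I}"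
proof -
  obtain \<tau> where \<tau>: "\<tau> \<in> carrier G" "\<phi> \<tau> e = x"
    by (rule transitive)
  have "measure \<mu> (inside {x}) = measure \<mu> {\<sigma> \<in> carrier G. inv \<tau> \<otimes> \<sigma> \<in> inside {e}}"
    using inside_translate[OF \<tau>(1), of e] \<tau>(2) by simp
  also have "\<dots> = measure \<mu> (inside {e})"
    using \<tau>(1) by (intro measure_translate inside_singleton_sets) simp
  also have "\<dots> = measure \<mu> {\<sigma> \<in> carrier G. \<phi> \<sigma> e \<in> I}"
    unfolding inside_singleton by (rule measure_inverse[OF orbit_vimage_sets])
  finally show ?thesis .
qed

section \<open>Continuity of the measure of the events\<close>

text \<open>Because the orbit map of \<open>x\<close> is open, moving \<open>x\<close> by group
  elements near \<open>\<one>\<close> fills a neighbourhood of \<open>x\<close>. The events of these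
  vertices are small translates of \<open>inside {x}\<close>.\<close>

lemma inside_singleton_nhds:
  assumes "\<epsilon> > 0"
  obtains W where "open W" "x \<in> W"
    "\<And>y. y \<in> W \<Longrightarrow> measure \<mu> (inside {x} - inside {y}) < \<epsilon>"
    "\<And>y. y \<in> W \<Longrightarrow> measure \<mu> (inside {y} - inside {x}) < \<epsilon>"
proof -
  obtain N where N: "openin T N" "\<one> \<in> N"
    "\<And>\<sigma>. \<sigma> \<in> N \<Longrightarrow> measure \<mu> (inside {x} - {\<tau> \<in> carrier G. \<sigma> \<otimes> \<tau> \<in> inside {x}}) < \<epsilon>"
    "\<And>\<sigma>. \<sigma> \<in> N \<Longrightarrow> measure \<mu> ({\<tau> \<in> carrier G. \<sigma> \<otimes> \<tau> \<in> inside {x}} - inside {x}) < \<epsilon>"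
    by (rule translation_continuous[OF inside_singleton_sets[of x] assms]) blast
  \<comment> \<open>Moving \<open>x\<close> by \<open>\<sigma>\<close> translates the event by
    \<open>inv \<sigma>\<close>, so it is \<open>inv \<sigma>\<close> that has to lie in
    \<open>N\<close>.\<close>
  define N' where "N' = {\<sigma> \<in> carrier G. inv \<sigma> \<in> N}"
  have "openin T N'"
    using openin_continuous_map_preimage[OF continuous_inv N(1)] by (simp add: N'_def)
  then have "open ((\<lambda>\<sigma>. \<phi> \<sigma> x) ` N')"
    using homogeneous by (simp add: homogeneous_space_def open_map_def)
  moreover have "x \<in> (\<lambda>\<sigma>. \<phi> \<sigma> x) ` N'"
    using N(2) action_one by (intro image_eqI[of _ _ "\<one>"]) (auto simp: N'_def)
  ultimately show ?thesis
    by (rule that) (use N(3,4) in \<open>auto simp: N'_def inside_translate\<close>)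
qed

text \<open>In a Vietoris neighbourhood every point of either set is close to a point of the other.
  Each difference of events is then covered by at most \<open>k\<close> differences for single
  vertices.\<close>

lemma inside_nhds:
  assumes S: "S \<in> Sub k" and "\<epsilon> > 0"
  obtains W where "openin (Sub_topology k) W" "S \<in> W"
    "\<And>S'. S' \<in> W \<Longrightarrow> measure \<mu> (inside S - inside S') < \<epsilon>"
    "\<And>S'. S' \<in> W \<Longrightarrow> measure \<mu> (inside S' - inside S) < \<epsilon>"
proof -
  \<comment> \<open>Dividing by \<open>k + 1\<close> keeps a sum of at most \<open>k\<close> terms
    strictly below \<open>\<epsilon>\<close>, also when \<open>k = 0\<close>.\<close>
  define \<delta> where "\<delta> = \<epsilon> / (real k + 1)"
  have \<delta>: "\<delta> > 0" "real k * \<delta> < \<epsilon>"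
    using \<open>\<epsilon> > 0\<close> by (auto simp: \<delta>_def field_simps)
  have "\<exists>W. open W \<and> x \<in> W \<and> (\<forall>y\<in>W. measure \<mu> (inside {x} - inside {y}) < \<delta> \<and>
      measure \<mu> (inside {y} - inside {x}) < \<delta>)" for x
    using inside_singleton_nhds[OF \<delta>(1)] by metis
  then obtain N where N: "\<And>x. open (N x)" "\<And>x. x \<in> N x"
    "\<And>x y. y \<in> N x \<Longrightarrow> measure \<mu> (inside {x} - inside {y}) < \<delta>"
    "\<And>x y. y \<in> N x \<Longrightarrow> measure \<mu> (inside {y} - inside {x}) < \<delta>"
    by metis
  have sum_bound: "measure \<mu> (\<Union>y\<in>R. inside {f y} - inside {g y}) < \<epsilon>"
    if "R \<in> Sub k" "\<And>y. y \<in> R \<Longrightarrow> measure \<mu> (inside {f y} - inside {g y}) < \<delta>" for R f g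
  proof -
    have R: "finite R" "card R \<le> k"
      using that(1) by (auto simp: Sub_def)
    have "measure \<mu> (\<Union>y\<in>R. inside {f y} - inside {g y}) \<le> (\<Sum>y\<in>R. measure \<mu> (inside {f y} - inside {g y}))"
      using R(1) inside_singleton_sets by (intro finite_measure_subadditive_finite) auto
    also have "\<dots> \<le> (\<Sum>y\<in>R. \<delta>)"
      using that(2) by (intro sum_mono) (simp add: less_imp_le)
    also have "\<dots> \<le> real k * \<delta>"
      using R(2) \<delta>(1) by (simp add: mult_right_mono)
    finally show ?thesis
      using \<delta>(2) by simp
  qed
  define W where "W = {S' \<in> Sub k. S' \<subseteq> \<Union>(N ` S) \<and> (\<forall>U\<in>N ` S. S' \<inter> U \<noteq> {})}"
  show ?thesis
  proof (rule that)
    show "openin (Sub_topology k) W"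
      unfolding W_def using S N(1) by (intro openin_Sub_vietoris) (auto simp: Sub_def)
    show "S \<in> W"
      using S N(2) by (auto simp: W_def)
    fix S' assume "S' \<in> W"
    then have S': "S' \<in> Sub k" "\<And>y. y \<in> S' \<Longrightarrow> \<exists>x\<in>S. y \<in> N x" "\<And>x. x \<in> S \<Longrightarrow> \<exists>y\<in>S'. y \<in> N x"
      by (auto simp: W_def)
    \<comment> \<open>If \<open>\<sigma>\<close> is in \<open>inside S\<close> but not in
      \<open>inside S'\<close>, it fails at some \<open>y \<in> S'\<close> and yet lies in
      \<open>inside {f y}\<close>, as \<open>f y \<in> S\<close>. The map \<open>g\<close> plays the
      same part for the opposite difference.\<close>
    obtain f where f: "\<And>y. y \<in> S' \<Longrightarrow> f y \<in> S" "\<And>y. y \<in> S' \<Longrightarrow> y \<in> N (f y)"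
      using S'(2) by metis
    obtain g where g: "\<And>x. x \<in> S \<Longrightarrow> g x \<in> S'" "\<And>x. x \<in> S \<Longrightarrow> g x \<in> N x"
      using S'(3) by metis
    have "measure \<mu> (inside S - inside S') \<le> measure \<mu> (\<Union>y\<in>S'. inside {f y} - inside {y})"
      using S'(1) f(1) inside_singleton_sets
      by (intro finite_measure_mono sets.finite_UN) (auto simp: inside_def Sub_def)
    also have "\<dots> < \<epsilon>"
      using S'(1) f(2) N(3) by (intro sum_bound) blast+
    finally show "measure \<mu> (inside S - inside S') < \<epsilon>" .
    have "measure \<mu> (inside S' - inside S) \<le> measure \<mu> (\<Union>x\<in>S. inside {g x} - inside {x})"
      using S g(1) inside_singleton_sets
      by (intro finite_measure_mono sets.finite_UN) (auto simp: inside_def Sub_def)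
    also have "\<dots> < \<epsilon>"
      using S g(2) N(4) by (intro sum_bound) blast+
    finally show "measure \<mu> (inside S' - inside S) < \<epsilon>" .
  qed
qed

text \<open>Replacing \<open>S\<close> and \<open>S'\<close> by nearby sets changes the measure of
  the triple intersection by at most the measures of the differences of the two events. With
  \<open>C = inside Q\<close> this covers all the moment kernels.\<close>

lemma continuous_kernel:
  assumes C: "C \<in> sets \<mu>"
  shows "continuous_map (prod_topology (Sub_topology k) (Sub_topology k)) euclideanreal
    (\<lambda>(S, S'). measure \<mu> (C \<inter> inside S \<inter> inside S'))"
proof (rule continuous_map_real_epsilonI, clarify)
  fix S S' :: "'v set" and \<epsilon> :: real
  assume "(S, S') \<in> topspace (prod_topology (Sub_topology k) (Sub_topology k))" and "\<epsilon> > 0"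
  then have S: "S \<in> Sub k" "S' \<in> Sub k" and "\<epsilon> / 2 > 0"
    by (auto simp: topspace_Sub_topology)
  obtain W where W: "openin (Sub_topology k) W" "S \<in> W"
    "\<And>R. R \<in> W \<Longrightarrow> measure \<mu> (inside S - inside R) < \<epsilon> / 2"
    "\<And>R. R \<in> W \<Longrightarrow> measure \<mu> (inside R - inside S) < \<epsilon> / 2"
    using inside_nhds[OF S(1) \<open>\<epsilon> / 2 > 0\<close>] by metis
  obtain W' where W': "openin (Sub_topology k) W'" "S' \<in> W'"
    "\<And>R. R \<in> W' \<Longrightarrow> measure \<mu> (inside S' - inside R) < \<epsilon> / 2"
    "\<And>R. R \<in> W' \<Longrightarrow> measure \<mu> (inside R - inside S') < \<epsilon> / 2"
    using inside_nhds[OF S(2) \<open>\<epsilon> / 2 > 0\<close>] by metis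
  \<comment> \<open>Stated for four arbitrary sets, because the absolute value needs it in both
    directions.\<close>
  have le: "measure \<mu> (C \<inter> inside R \<inter> inside R') \<le>
      measure \<mu> (C \<inter> inside Q \<inter> inside Q') + measure \<mu> (inside R - inside Q) + measure \<mu> (inside R' - inside Q')"
    if "R \<in> Sub k" "R' \<in> Sub k" "Q \<in> Sub k" "Q' \<in> Sub k" for R R' Q Q'
  proof -
    have s: "inside R \<in> sets \<mu>" "inside R' \<in> sets \<mu>" "inside Q \<in> sets \<mu>" "inside Q' \<in> sets \<mu>"
      using that by (auto simp: Sub_def intro: inside_sets)
    have "measure \<mu> (C \<inter> inside R \<inter> inside R') \<le>
        measure \<mu> (((C \<inter> inside Q \<inter> inside Q') \<union> (inside R - inside Q)) \<union> (inside R' - inside Q'))"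
      using s C by (intro finite_measure_mono) auto
    also have "\<dots> \<le> measure \<mu> ((C \<inter> inside Q \<inter> inside Q') \<union> (inside R - inside Q)) + measure \<mu> (inside R' - inside Q')"
      using s C by (intro measure_Un_le) auto
    also have "measure \<mu> ((C \<inter> inside Q \<inter> inside Q') \<union> (inside R - inside Q)) \<le>
        measure \<mu> (C \<inter> inside Q \<inter> inside Q') + measure \<mu> (inside R - inside Q)"
      using s C by (intro measure_Un_le) auto
    finally show ?thesis by simp
  qed
  show "\<exists>U. openin (prod_topology (Sub_topology k) (Sub_topology k)) U \<and> (S, S') \<in> U \<and>
      (\<forall>y\<in>U. \<bar>(case y of (S, S') \<Rightarrow> measure \<mu> (C \<inter> inside S \<inter> inside S')) -
        measure \<mu> (C \<inter> inside S \<inter> inside S')\<bar> < \<epsilon>)"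
  proof (intro exI[of _ "W \<times> W'"] conjI)
    show "openin (prod_topology (Sub_topology k) (Sub_topology k)) (W \<times> W')"
      using W(1) W'(1) by (simp add: openin_prod_Times_iff)
    show "\<forall>y\<in>W \<times> W'. \<bar>(case y of (S, S') \<Rightarrow> measure \<mu> (C \<inter> inside S \<inter> inside S')) -
        measure \<mu> (C \<inter> inside S \<inter> inside S')\<bar> < \<epsilon>"
    proof clarify
      fix R R' assume R: "R \<in> W" "R' \<in> W'"
      then have "R \<in> Sub k" "R' \<in> Sub k"
        using openin_subset[OF W(1)] openin_subset[OF W'(1)] by (auto simp: topspace_Sub_topology)
      then show "\<bar>measure \<mu> (C \<inter> inside R \<inter> inside R') - measure \<mu> (C \<inter> inside S \<inter> inside S')\<bar> < \<epsilon>"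
        using le[OF _ _ S, of R R'] le[OF S, of R R'] W(3,4)[OF R(1)] W'(3,4)[OF R(2)] by linarith
    qed
  qed (use W W' in auto)
qed

text \<open>This is the kernel for \<open>C = carrier G\<close> restricted to the diagonal.\<close>

lemma continuous_measure_inside:
  "continuous_map (Sub_topology k) euclideanreal (\<lambda>S. measure \<mu> (inside S))"
proof -
  have "continuous_map (Sub_topology k) euclideanreal
      ((\<lambda>(S, S'). measure \<mu> (carrier G \<inter> inside S \<inter> inside S')) \<circ> (\<lambda>S. (S, S)))"
    using sets.top[of \<mu>]
    by (intro continuous_map_compose[OF _ continuous_kernel[of _ k]])
       (auto simp: continuous_map_pairwise o_def)
  moreover have "carrier G \<inter> inside S \<inter> inside S = inside S" for S
    by (auto simp: inside_def)
  ultimately show ?thesis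
    by (simp add: o_def)
qed

section \<open>Feasibility for both hierarchies\<close>

text \<open>Unions become intersections of events, so the kernel is a Gram kernel. The case
  \<open>Q = {}\<close> serves the Lasserre hierarchy, the case of sets of size at most one the
  \<open>k\<close>-point bound.\<close>

lemma psd_measure_inside:
  assumes "finite Q"
  shows "psd_kernel (Sub_topology k) (\<lambda>S S'. measure \<mu> (inside (Q \<union> S \<union> S')))"
  unfolding psd_kernel_def inside_Un
proof (intro conjI ballI allI impI)
  show "continuous_map (prod_topology (Sub_topology k) (Sub_topology k)) euclideanreal
      (\<lambda>(S, S'). measure \<mu> (inside Q \<inter> inside S \<inter> inside S'))"
    using assms by (intro continuous_kernel inside_sets)
  show "measure \<mu> (inside Q \<inter> inside S \<inter> inside S') = measure \<mu> (inside Q \<inter> inside S' \<inter> inside S)" for S S'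
    by (simp add: Int_ac)
  show "0 \<le> (\<Sum>S\<in>U. \<Sum>S'\<in>U. c S * c S' * measure \<mu> (inside Q \<inter> inside S \<inter> inside S'))"
    if "finite U \<and> U \<subseteq> topspace (Sub_topology k)" for U and c :: "'v set \<Rightarrow> real"
    using that assms
    by (intro gram_measure_nonneg inside_sets) (auto simp: topspace_Sub_topology Sub_def)
qed

text \<open>For \<open>\<sigma>\<close> in the event, \<open>inv \<sigma>\<close> would carry an
  edge within \<open>S\<close> to an edge within \<open>I\<close>.\<close>

lemma inside_not_independent:
  assumes "independent_set E I" "\<And>\<sigma> x y. \<sigma> \<in> carrier G \<Longrightarrow> (x, y) \<in> E \<Longrightarrow> (\<phi> \<sigma> x, \<phi> \<sigma> y) \<in> E"
    and "\<not> independent_set E S"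
  shows "inside S = {}"
proof (rule ccontr)
  assume "inside S \<noteq> {}"
  then obtain \<sigma> where \<sigma>: "\<sigma> \<in> carrier G" "\<And>x. x \<in> S \<Longrightarrow> \<phi> (inv \<sigma>) x \<in> I"
    by (auto simp: inside_def)
  obtain x y where "x \<in> S" "y \<in> S" "(x, y) \<in> E"
    using assms(3) by (auto simp: independent_set_def)
  then show False
    using assms(1) assms(2)[of "inv \<sigma>" x y] \<sigma> by (auto simp: independent_set_def)
qed

lemma lass_feasible_measure_inside:
  assumes "independent_set E I" "\<And>\<sigma> x y. \<sigma> \<in> carrier G \<Longrightarrow> (x, y) \<in> E \<Longrightarrow> (\<phi> \<sigma> x, \<phi> \<sigma> y) \<in> E"
  shows "lass_feasible k E (\<lambda>S. measure \<mu> (inside S))"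
  using continuous_measure_inside psd_measure_inside[of "{}"] inside_not_independent[OF assms]
  by (simp add: lass_feasible_def inside_empty)

lemma k_point_feasible_measure_inside:
  assumes "independent_set E I" "\<And>\<sigma> x y. \<sigma> \<in> carrier G \<Longrightarrow> (x, y) \<in> E \<Longrightarrow> (\<phi> \<sigma> x, \<phi> \<sigma> y) \<in> E"
  shows "k_point_feasible k E (\<lambda>S. measure \<mu> (inside S))"
  using continuous_measure_inside psd_measure_inside inside_not_independent[OF assms]
  by (simp add: k_point_feasible_def inside_empty Sub_def)

section \<open>The pushforward measure and the objective value\<close>

lemma orbit_measurable: "(\<lambda>\<sigma>. \<phi> \<sigma> e) \<in> borel_measurable \<mu>"
proof (rule borel_measurableI)
  fix U :: "'v set" assume "open U"
  then have "openin T {\<sigma> \<in> topspace T. \<phi> \<sigma> e \<in> U}"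
    by (intro openin_continuous_map_preimage[OF continuous_orbit]) simp
  moreover have "{\<sigma> \<in> topspace T. \<phi> \<sigma> e \<in> U} = (\<lambda>\<sigma>. \<phi> \<sigma> e) -` U \<inter> space \<mu>"
    by auto
  ultimately show "(\<lambda>\<sigma>. \<phi> \<sigma> e) -` U \<inter> space \<mu> \<in> sets \<mu>"
    by (metis open_in_sets)
qed

lemma integral_measure_inside:
  fixes e :: 'v
  defines "\<omega> \<equiv> distr \<mu> borel (\<lambda>\<sigma>. \<phi> \<sigma> e)"
  shows "(\<integral>x. measure \<mu> (inside {x}) \<partial>\<omega>) = measure \<omega> I"
    and "emeasure \<omega> I = ennreal (measure \<omega> I)"
proof -
  have vimage: "(\<lambda>\<sigma>. \<phi> \<sigma> e) -` J \<inter> space \<mu> = {\<sigma> \<in> carrier G. \<phi> \<sigma> e \<in> J}" for J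
    by auto
  have "measure \<omega> J = measure \<mu> {\<sigma> \<in> carrier G. \<phi> \<sigma> e \<in> J}" if "J \<in> sets borel" for J
    using that by (simp add: \<omega>_def measure_distr[OF orbit_measurable] vimage del: space_haar)
  \<comment> \<open>The integrand is constant with value \<open>measure \<omega> I\<close>, and the
    instance for \<open>UNIV\<close> shows that \<open>\<omega>\<close> has total mass one.\<close>
  from this[OF I_borel] this[of UNIV]
  show "(\<integral>x. measure \<mu> (inside {x}) \<partial>\<omega>) = measure \<omega> I"
    by (simp add: measure_inside_singleton[of _ e] \<omega>_def)
  show "emeasure \<omega> I = ennreal (measure \<omega> I)"
    using finite_measure_distr[OF orbit_measurable[of e]]
    by (simp add: \<omega>_def finite_measure.emeasure_eq_measure)
qed

end

section \<open>Lower bounds by the measure of independent sets\<close>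

theorem theorem3p1:
  fixes E :: "('v::t2_space \<times> 'v) set"
    and \<Gamma> :: "('v \<Rightarrow> 'v) set"
    and T :: "('v \<Rightarrow> 'v) topology"
    and \<mu> :: "('v \<Rightarrow> 'v) measure"
    and \<omega> :: "'v measure"
    and e :: 'v
  assumes "graph_edges E"
    and "subgroup \<Gamma> (aut_group E)"
    and "topological_group ((aut_group E)\<lparr>carrier := \<Gamma>\<rparr>) T"
    and "compact_space T"
    and "homogeneous_space ((aut_group E)\<lparr>carrier := \<Gamma>\<rparr>) T euclidean (\<lambda>\<sigma> x. \<sigma> x)"
    and "normalized_haar_measure ((aut_group E)\<lparr>carrier := \<Gamma>\<rparr>) T \<mu>"
    and "\<omega> = distr \<mu> borel (\<lambda>\<sigma>. \<sigma> e)"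
  shows "(\<forall>k\<ge>1. lass k E \<omega> \<ge> indep_ratio E \<omega>) \<and>
         (\<forall>k\<ge>2. k_point_bound k E \<omega> \<ge> indep_ratio E \<omega>)"
proof -
  \<comment> \<open>Each independent Borel set is treated separately; the supremum over such sets is
    taken only at the end.\<close>
  have "lass k E \<omega> \<ge> enn2ereal (emeasure \<omega> I) \<and> k_point_bound k E \<omega> \<ge> enn2ereal (emeasure \<omega> I)"
    if I: "independent_set E I" "I \<in> sets \<omega>" for I k
  proof -
    let ?G = "(aut_group E)\<lparr>carrier := \<Gamma>\<rparr>"
    have "group ?G"
      using assms(3) by (simp add: topological_group_def)
    moreover have "I \<in> sets borel"
      using I(2) assms(7) by simp
    ultimately interpret compact_homogeneous ?G T \<mu> "\<lambda>\<sigma> x. \<sigma> x" I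
      using assms
      by (simp add: compact_homogeneous_def compact_homogeneous_axioms_def compact_haar_def
          compact_haar_axioms_def)
    have edges: "(\<sigma> x, \<sigma> y) \<in> E" if "\<sigma> \<in> carrier ?G" "(x, y) \<in> E" for \<sigma> x y
      using that subgroup.subset[OF assms(2)] by (auto simp: aut_group_def)
    \<comment> \<open>As \<open>\<omega>\<close> is finite on \<open>I\<close>, its extended value
      is the real objective value of the feasible function built from \<open>I\<close>.\<close>
    have "enn2ereal (emeasure \<omega> I) = ereal (\<integral>x. measure \<mu> (inside {x}) \<partial>\<omega>)"
      using integral_measure_inside[of e] by (simp add: assms(7) enn2ereal_ennreal)
    then show ?thesis
      unfolding lass_def k_point_bound_def
      using lass_feasible_measure_inside[OF I(1), of k] k_point_feasible_measure_inside[OF I(1), of k] edges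
      by (auto intro!: SUP_upper2[where i = "\<lambda>S. measure \<mu> (inside S)"])
  qed
  then show ?thesis
    by (auto simp: indep_ratio_def intro!: SUP_least)
qed

end
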